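(* Suppose that $K$ and $K''$ are functions of bounded variation on $\mathbb{R}$, that the density $f$ is uniformly continuous, and that $\dfrac{nh^2}{\log\log n}\to+\infty$ as $n\to+\infty$. Then for every $M>0$ the estimator $P_{n,b}(z,\alpha)$ converges to $P(z,\alpha)$ uniformly in $z\in[0,M]$ almost surely, i.e. $$\mathbb{P}\Big(\lim_{n\to+\infty}\ \sup_{z\in[0,M]}\big|P_{n,b}(z,\alpha)-P(z,\alpha)\big|=0\Big)=1 .$$
   Context: Fix a real $\alpha$ with $\alpha=0$ or $\alpha\ge 1$. Let $X_1,X_2,\dots$ be i.i.d. real random variables with cumulative distribution function $F$ and continuous, bounded probability density $f$ whose support is contained in $\mathbb{R}_+$. The FGT poverty index is $P(z,\alpha)=\int_0^z\big(\frac{z-x}{z}\big)^{\alpha}f(x)\,dx$ if $z>0$, and $P(z,\alpha)=0$ otherwise. Bandwidth: $h=h(n)>0$ with $h\to0$ as $n\to\infty$. Kernel: $K:\mathbb{R}\to\mathbb{R}$ is such that both $K$ and $K''$ are twice continuously differentiable and integrable on $\mathbb{R}$ (with $\int|K|<\infty$ and $\int|K''|<\infty$); $K$ and $K''$ are bounded; $\int_{\mathbb{R}}K(x)\,dx=1$; $\lim_{x\to\pm\infty}|xK(x)|=0$ and $\lim_{x\to\pm\infty}|xK''(x)|=0$; and $\int_{\mathbb{R}}u^2K(u)\,du$ is finite. Estimator: for $z>0$, $$P_{n,b}(z,\alpha)=\frac1n\sum_{j=1}^n\sum_{i=0}^{[z/h]}\Big(\frac{z-ih}{z}\Big)^{\alpha}\Big[K\Big(\frac{ih-X_j}{h}\Big)-\frac{h^2}{2}\Big(\int_{\mathbb{R}}u^2K(u)\,du\Big)K''\Big(\frac{ih-X_j}{h}\Big)\Big],$$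 where $[\cdot]$ is the integer part and $0^0=1$; $P_{n,b}(z,\alpha)=0$ for $z\le0$. *)

theory Defs
  imports "HOL-Probability.Probability"
begin

text \<open>Unlike \<open>(powr)\<close>, for which \<open>0 powr 0 = 0\<close>, this power satisfies \<open>0\<^sup>0 = 1\<close>.\<close>

definition fgt_power :: "real \<Rightarrow> real \<Rightarrow> real" where
  "fgt_power x \<alpha> = (if \<alpha> = 0 then 1 else x powr \<alpha>)"

definition fgt_index :: "(real \<Rightarrow> real) \<Rightarrow> real \<Rightarrow> real \<Rightarrow> real" where
  "fgt_index f \<alpha> z =
     (if z > 0 then LBINT x:{0..z}. fgt_power ((z - x) / z) \<alpha> * f x else 0)"

definition C2 :: "(real \<Rightarrow> real) \<Rightarrow> bool" where
  "C2 g \<longleftrightarrow> g differentiable_on UNIV \<and> deriv g differentiable_on UNIV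
          \<and> continuous_on UNIV (deriv (deriv g))"

abbreviation second_deriv :: "(real \<Rightarrow> real) \<Rightarrow> real \<Rightarrow> real" where
  "second_deriv g \<equiv> deriv (deriv g)"

definition bias_reducing_kernel :: "(real \<Rightarrow> real) \<Rightarrow> bool" where
  "bias_reducing_kernel K \<longleftrightarrow>
     (\<forall>g \<in> {K, second_deriv K}.
        C2 g \<and> integrable lborel g \<and> bounded (range g)
        \<and> ((\<lambda>x. \<bar>x * g x\<bar>) \<longlongrightarrow> 0) at_top \<and> ((\<lambda>x. \<bar>x * g x\<bar>) \<longlongrightarrow> 0) at_bot)
     \<and> (LBINT x. K x) = 1
     \<and> integrable lborel (\<lambda>u. u\<^sup>2 * K u)"

text \<open>
  Bounded total variation over the whole real line. A finite partition
  \<open>x 0 \<le> \<dots> \<le> x n\<close> is represented by a monotone sequence, of which only the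
  first \<open>n + 1\<close> terms matter.
\<close>

definition bounded_variation :: "(real \<Rightarrow> real) \<Rightarrow> bool" where
  "bounded_variation g \<longleftrightarrow>
     (\<exists>V. \<forall>n::nat. \<forall>x::nat \<Rightarrow> real. mono x \<longrightarrow> (\<Sum>i<n. \<bar>g (x (Suc i)) - g (x i)\<bar>) \<le> V)"

text \<open>
  The estimator computed with bandwidth \<open>h\<close> from the observations
  \<open>x 1, \<dots>, x n\<close>; the value of \<open>x 0\<close> is irrelevant.
\<close>

definition fgt_estimator ::
  "(real \<Rightarrow> real) \<Rightarrow> real \<Rightarrow> nat \<Rightarrow> (nat \<Rightarrow> real) \<Rightarrow> real \<Rightarrow> real \<Rightarrow> real" where
  "fgt_estimator K h n x \<alpha> z =
     (if z > 0 then
        1 / real n *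
        (\<Sum>j=1..n. \<Sum>i=0..nat \<lfloor>z / h\<rfloor>.
           fgt_power ((z - real i * h) / z) \<alpha> *
           (K ((real i * h - x j) / h)
            - h\<^sup>2 / 2 * (LBINT u. u\<^sup>2 * K u) * second_deriv K ((real i * h - x j) / h)))
      else 0)"

end

theory Submission
  imports Defs "HOL-Real_Asymp.Real_Asymp"
begin

text \<open>
  No law of the iterated logarithm is needed. For fixed \<open>z\<close> the weights
  \<open>((z - i h) / z)\<^sup>\<alpha>\<close> decrease in \<open>i\<close> from \<open>1\<close>, so by Abel summation the centred first part
  of the estimator is bounded, uniformly in \<open>z \<in> [0, M]\<close>, by the maximum over the finitely many
  \<open>m \<le> M / h\<close> of the deviations of the averages over \<open>j\<close> of \<open>\<Sum>i\<le>m. K (i - X j / h)\<close>. These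
  summands are bounded by a constant, because lattice sums of an integrable function of bounded
  variation are. Hoeffding's inequality, a union bound over \<open>O(n)\<close> values of \<open>m\<close> (the growth
  condition forces \<open>1 / h \<le> n\<close> eventually) and Borel--Cantelli give almost sure convergence
  to \<open>0\<close>. The part containing \<open>K''\<close> is \<open>O(h\<^sup>2)\<close> deterministically, and what remains is a
  convolution estimate for \<open>f\<close> and a Riemann sum estimate, both uniform.
\<close>

section \<open>Lattice sums of functions of bounded variation, and Abel summation\<close>

lemma set_integral_consecutive_cells:
  fixes g :: "real \<Rightarrow> real"
  assumes h: "h > 0" and int: "set_integrable lborel {a..<a + real (Suc m) * h} g"
  shows "(\<Sum>i\<le>m. LBINT x:{a + real i * h..<a + real (Suc i) * h}. g x)
           = (LBINT x:{a..<a + real (Suc m) * h}. g x)"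
  using int
proof (induction m)
  case 0
  then show ?case by simp
next
  case (Suc m)
  define b c where "b = a + real (Suc m) * h" and "c = a + real (Suc (Suc m)) * h"
  have bc: "a \<le> b" "b \<le> c" using h by (auto simp: b_def c_def algebra_simps)
  have un: "{a..<c} = {a..<b} \<union> {b..<c}" using bc by auto
  have int: "set_integrable lborel {a..<b} g" "set_integrable lborel {b..<c} g"
    using Suc.prems bc unfolding c_def[symmetric] by (auto elim!: set_integrable_subset)
  have "(\<Sum>i\<le>Suc m. LBINT x:{a + real i * h..<a + real (Suc i) * h}. g x)
     = (LBINT x:{a..<b}. g x) + (LBINT x:{b..<c}. g x)"
    using Suc.IH int by (simp add: b_def c_def)
  also have "\<dots> = (LBINT x:{a..<c}. g x)"
    unfolding un using int by (intro set_integral_Un[symmetric]) auto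
  finally show ?case by (simp only: c_def)
qed

text \<open>In every unit cell \<open>\<bar>g\<bar>\<close> attains its minimum, which is at most
  its integral over the cell. The value at the left lattice point exceeds that minimum by at most an
  increment of \<open>g\<close> inside the cell. Summed over the cells, the integrals give at most
  the L1 norm and the increments at most the total variation, whatever the shift
  \<open>t\<close>.\<close>

lemma lattice_sum_bounded:
  fixes g :: "real \<Rightarrow> real"
  assumes cont: "continuous_on UNIV g" and int: "integrable lborel g" and bv: "bounded_variation g"
  shows "\<exists>C>0. \<forall>t m. (\<Sum>i\<le>m. \<bar>g (real i - t)\<bar>) \<le> C"
proof -
  obtain V where V: "\<And>n x. mono x \<Longrightarrow> (\<Sum>i<n. \<bar>g (x (Suc i)) - g (x i)\<bar>) \<le> V"
    using bv unfolding bounded_variation_def by blast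
  have V0: "V \<ge> 0" using V[of "\<lambda>_. 0" 0] by (simp add: mono_def)
  define J where "J = (LBINT x. \<bar>g x\<bar>)"
  have J0: "J \<ge> 0" unfolding J_def by simp
  have ia: "integrable lborel (\<lambda>x. \<bar>g x\<bar>)" using int by simp
  have iS: "set_integrable lborel A (\<lambda>x. \<bar>g x\<bar>)" if "A \<in> sets lborel" for A
    unfolding set_integrable_def using that by (intro integrable_mult_indicator ia)
  have main: "(\<Sum>i\<le>m. \<bar>g (real i - t)\<bar>) \<le> J + V" for t m
  proof -
    define cell where "cell i = {-t + real i * 1..<-t + real (Suc i) * 1}" for i
    have "\<exists>x\<in>{-t + real i..-t + real (Suc i)}. \<bar>g x\<bar> \<le> (LBINT y:cell i. \<bar>g y\<bar>)" for i
    proof -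
      have "continuous_on {-t + real i..-t + real (Suc i)} (\<lambda>x. \<bar>g x\<bar>)"
        by (intro continuous_on_rabs continuous_on_subset[OF cont]) auto
      then obtain x where x: "x \<in> {-t + real i..-t + real (Suc i)}"
        and le: "\<And>y. y \<in> {-t + real i..-t + real (Suc i)} \<Longrightarrow> \<bar>g x\<bar> \<le> \<bar>g y\<bar>"
        using continuous_attains_inf[of "{-t + real i..-t + real (Suc i)}" "\<lambda>x. \<bar>g x\<bar>"] by auto
      have "\<bar>g x\<bar> = (LBINT y:cell i. \<bar>g x\<bar>)"
        by (simp add: cell_def set_integral_const)
      also have "\<dots> \<le> (LBINT y:cell i. \<bar>g y\<bar>)"
        using le by (intro set_integral_mono iS) (auto simp: cell_def set_integrable_def)
      finally show ?thesis using x by blast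
    qed
    then obtain \<xi> where \<xi>: "\<And>i. \<xi> i \<in> {-t + real i..-t + real (Suc i)}"
      and le: "\<And>i. \<bar>g (\<xi> i)\<bar> \<le> (LBINT y:cell i. \<bar>g y\<bar>)" by metis
    \<comment> \<open>Lattice points at even indices interleaved with the minimisers at odd indices:
      one monotone sequence, to which the variation bound applies.\<close>
    define y where "y k = (if even k then -t + real (k div 2) else \<xi> (k div 2))" for k
    have ymono: "mono y"
    proof (rule incseq_SucI)
      fix k show "y k \<le> y (Suc k)"
        using \<xi>[of "k div 2"] by (auto simp: y_def elim!: oddE)
    qed
    have "(\<Sum>i\<le>m. \<bar>g (real i - t)\<bar>) \<le> (\<Sum>i\<le>m. (LBINT y:cell i. \<bar>g y\<bar>) + \<bar>g (\<xi> i) - g (real i - t)\<bar>)"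
    proof (rule sum_mono)
      fix i show "\<bar>g (real i - t)\<bar> \<le> (LBINT y:cell i. \<bar>g y\<bar>) + \<bar>g (\<xi> i) - g (real i - t)\<bar>"
        using le[of i] by linarith
    qed
    also have "\<dots> = (\<Sum>i\<le>m. LBINT y:cell i. \<bar>g y\<bar>) + (\<Sum>i\<le>m. \<bar>g (\<xi> i) - g (real i - t)\<bar>)"
      by (rule sum.distrib)
    also have "(\<Sum>i\<le>m. LBINT y:cell i. \<bar>g y\<bar>) \<le> J"
    proof -
      have "(\<Sum>i\<le>m. LBINT y:cell i. \<bar>g y\<bar>) = (LBINT x:{-t..<-t + real (Suc m) * 1}. \<bar>g x\<bar>)"
        unfolding cell_def by (intro set_integral_consecutive_cells iS) auto
      also have "\<dots> \<le> J"
        unfolding set_lebesgue_integral_def J_def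
        by (intro integral_mono ia iS[unfolded set_integrable_def]) (auto simp: indicator_def)
      finally show ?thesis .
    qed
    also have "(\<Sum>i\<le>m. \<bar>g (\<xi> i) - g (real i - t)\<bar>) \<le> V"
    proof -
      have "(\<Sum>i\<le>m. \<bar>g (\<xi> i) - g (real i - t)\<bar>)
          \<le> (\<Sum>i<2 * Suc m. \<bar>g (y (Suc i)) - g (y i)\<bar>)"
      \<comment> \<open>The wanted increments are those of even index in the sum over
        \<open>y\<close>; those of odd index are nonnegative and only enlarge it.\<close>
      proof (induction m)
        case 0
        then show ?case by (simp add: y_def eval_nat_numeral)
      next
        case (Suc m)
        have "2 * Suc (Suc m) = Suc (Suc (2 * Suc m))" by simp
        then show ?case using Suc by (simp add: y_def del: mult_Suc_right)
      qed
      also have "\<dots> \<le> V" by (rule V[OF ymono])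
      finally show ?thesis .
    qed
    finally show ?thesis by simp
  qed
  \<comment> \<open>Both \<open>J\<close> and \<open>V\<close> may vanish, so 1 is added to make the
    constant strictly positive.\<close>
  have "J + V + 1 > 0" using J0 V0 by simp
  moreover have "\<forall>t m. (\<Sum>i\<le>m. \<bar>g (real i - t)\<bar>) \<le> J + V + 1"
    using main by (metis add_increasing2 zero_le_one order_trans less_eq_real_def)
  ultimately show ?thesis by blast
qed

text \<open>Summation by parts turns the weighted sum into a combination of partial sums of
  \<open>a\<close>, with nonnegative coefficients \<open>w N\<close> and
  \<open>w k - w (Suc k)\<close>. These telescope to \<open>w 0\<close>, which is at most 1.\<close>

lemma abel_sum_bound:
  fixes w a :: "nat \<Rightarrow> real"
  assumes w0: "w 0 \<le> 1" and wnn: "0 \<le> w N" and anti: "\<And>i. i < N \<Longrightarrow> w (Suc i) \<le> w i"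
    and a: "\<And>m. m \<le> N \<Longrightarrow> \<bar>\<Sum>i\<le>m. a i\<bar> \<le> e"
  shows "\<bar>\<Sum>i\<le>N. w i * a i\<bar> \<le> e"
proof -
  have parts: "(\<Sum>i\<le>m. w i * a i) = w m * (\<Sum>i\<le>m. a i) + (\<Sum>k<m. (w k - w (Suc k)) * (\<Sum>i\<le>k. a i))" for m
    by (induction m) (simp_all add: algebra_simps)
  have e0: "0 \<le> e" using a[of 0] by linarith
  have "\<bar>\<Sum>i\<le>N. w i * a i\<bar> \<le> \<bar>w N * (\<Sum>i\<le>N. a i)\<bar> + (\<Sum>k<N. \<bar>(w k - w (Suc k)) * (\<Sum>i\<le>k. a i)\<bar>)"
    unfolding parts by (intro order_trans[OF abs_triangle_ineq] add_left_mono sum_abs)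
  also have "\<dots> \<le> w N * e + (\<Sum>k<N. (w k - w (Suc k)) * e)"
    using anti wnn a by (intro add_mono sum_mono) (auto simp: abs_mult intro!: mult_mono)
  also have "\<dots> = w 0 * e"
    using arg_cong[OF sum_lessThan_telescope'[of w N], of "\<lambda>s. (w N + s) * e"]
    by (simp add: sum_distrib_right[symmetric] distrib_right)
  also have "\<dots> \<le> e" using mult_right_mono[OF w0 e0] by simp
  finally show ?thesis .
qed

section \<open>Poverty weights, Riemann sums and smoothing by the kernel\<close>

text \<open>Cutting off to 0 beyond \<open>z\<close> keeps the weight decreasing, so the integral
  over \<open>{0..z}\<close> can be extended to a whole number of cells of length
  \<open>h\<close>.\<close>

definition fgt_weight :: "real \<Rightarrow> real \<Rightarrow> real \<Rightarrow> real" where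
  "fgt_weight \<alpha> z x = (if x \<le> z then fgt_power ((z - x) / z) \<alpha> else 0)"

lemma fgt_weight_nonneg: "0 \<le> fgt_weight \<alpha> z x"
  by (simp add: fgt_weight_def fgt_power_def)

lemma fgt_weight_0: "z > 0 \<Longrightarrow> fgt_weight \<alpha> z 0 = 1"
  by (simp add: fgt_weight_def fgt_power_def)

lemma fgt_weight_antimono:
  assumes "z > 0" "\<alpha> \<ge> 0" "x \<le> y"
  shows "fgt_weight \<alpha> z y \<le> fgt_weight \<alpha> z x"
  using assms by (auto simp: fgt_weight_def fgt_power_def intro!: powr_mono2 divide_right_mono)

lemma fgt_weight_le_1:
  assumes "z > 0" "\<alpha> \<ge> 0" "x \<ge> 0"
  shows "fgt_weight \<alpha> z x \<le> 1"
  using fgt_weight_antimono[OF assms] fgt_weight_0[OF assms(1)] by simp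

lemma fgt_weight_measurable [measurable]: "fgt_weight \<alpha> z \<in> borel_measurable borel"
  unfolding fgt_weight_def fgt_power_def by measurable

text \<open>No modulus of continuity of \<open>w\<close> enters, which matters because the weights
  become steep for small \<open>z\<close> and jump at \<open>z\<close> if
  \<open>\<alpha> = 0\<close>. On each cell the oscillation of \<open>f\<close> costs
  \<open>h * \<eta>\<close> and the drop of \<open>w\<close> costs \<open>B * h\<close> times that
  drop; the drops telescope to at most 1.\<close>

lemma antimono_riemann_sum:
  fixes w f :: "real \<Rightarrow> real"
  assumes h: "h > 0" and wm: "w \<in> borel_measurable borel"
    and w: "\<And>x. 0 \<le> w x" "w 0 \<le> 1" "\<And>x y. 0 \<le> x \<Longrightarrow> x \<le> y \<Longrightarrow> w y \<le> w x"
    and fm: "f \<in> borel_measurable borel"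
    and f: "\<And>x. 0 \<le> f x" "\<And>x. f x \<le> B" "\<And>x y. \<bar>x - y\<bar> \<le> h \<Longrightarrow> \<bar>f x - f y\<bar> \<le> \<eta>"
  shows "\<bar>(\<Sum>i\<le>N. w (real i * h) * (h * f (real i * h))) - (LBINT x:{0..<real (Suc N) * h}. w x * f x)\<bar>
           \<le> real (Suc N) * h * \<eta> + B * h"
proof -
  define cell where "cell i = {0 + real i * h..<0 + real (Suc i) * h}" for i
  have w1: "w x \<le> 1" if "0 \<le> x" for x using w(3)[of 0 x] w(2) that by simp
  have B0: "0 \<le> B" using f(1)[of 0] f(2)[of 0] by linarith
  have \<eta>0: "0 \<le> \<eta>" using f(3)[of 0 0] h by simp
  have int: "set_integrable lborel {a..<b} (\<lambda>x. w x * f x)" if "0 \<le> a" for a b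
    unfolding set_integrable_def
  proof (rule Bochner_Integration.integrable_bound)
    show "integrable lborel (\<lambda>x. indicator {a..<b} x *\<^sub>R B)"
      by (cases "a \<le> b") auto
    show "AE x in lborel. norm (indicator {a..<b} x *\<^sub>R (w x * f x)) \<le> norm (indicator {a..<b} x *\<^sub>R B)"
    proof (rule AE_I2)
      fix x
      show "norm (indicator {a..<b} x *\<^sub>R (w x * f x)) \<le> norm (indicator {a..<b} x *\<^sub>R B)"
        using mult_mono[of "w x" 1 "f x" B] w(1)[of x] w1[of x] f(1)[of x] f(2)[of x] that B0
        by (auto simp: indicator_def)
    qed
  qed (use wm fm in measurable)
  have cellbd: "\<bar>w (real i * h) * (h * f (real i * h)) - (LBINT x:cell i. w x * f x)\<bar>
      \<le> h * \<eta> + B * h * (w (real i * h) - w (real (Suc i) * h))" for i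
  proof -
    define a where "a = real i * h"
    have a0: "0 \<le> a" using h by (simp add: a_def)
    have ah: "real (Suc i) * h = a + h" by (simp add: a_def algebra_simps)
    have cell: "cell i = {a..<a + h}" by (simp add: cell_def a_def algebra_simps)
    have c: "w a * (h * f a) = (LBINT x:cell i. w a * f a)"
      using h by (simp add: cell set_integral_const)
    have ci: "set_integrable lborel (cell i) (\<lambda>x. c)" for c :: real
      using h by (simp add: cell set_integrable_def)
    have i1: "set_integrable lborel (cell i) (\<lambda>x. w x * f x)"
      unfolding cell by (rule int[OF a0])
    have pt: "\<bar>w a * f a - w x * f x\<bar> \<le> \<eta> + B * (w a - w (a + h))" if "x \<in> cell i" for x
    proof -
      have x: "a \<le> x" "x \<le> a + h" using that by (auto simp: cell)
      \<comment> \<open>The splitting pairs the oscillation of \<open>f\<close> with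
        \<open>w a\<close>, at most 1, and the drop of \<open>w\<close> with \<open>f x\<close>, at
        most \<open>B\<close>.\<close>
      have "w a * f a - w x * f x = w a * (f a - f x) + (w a - w x) * f x"
        by (simp add: algebra_simps)
      also have "\<bar>\<dots>\<bar> \<le> w a * \<bar>f a - f x\<bar> + (w a - w x) * f x"
        using w(1)[of a] w(3)[of a x] a0 x f(1)[of x]
        by (intro order_trans[OF abs_triangle_ineq]) (simp add: abs_mult)
      also have "\<dots> \<le> 1 * \<eta> + (w a - w (a + h)) * B"
        using w(1)[of a] w1[of a] w(3)[of a x] w(3)[of x "a + h"] a0 x f(1)[of x] f(2)[of x] f(3)[of a x] \<eta>0
        by (intro add_mono mult_mono) auto
      finally show ?thesis by (simp add: mult.commute)
    qed
    have "w a * (h * f a) - (LBINT x:cell i. w x * f x) = (LBINT x:cell i. w a * f a - w x * f x)"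
      unfolding c by (rule set_integral_diff(2)[symmetric, OF ci i1])
    also have "\<bar>\<dots>\<bar> \<le> (LBINT x:cell i. \<bar>w a * f a - w x * f x\<bar>)"
      using set_integral_norm_bound[OF set_integral_diff(1)[OF ci i1]] by simp
    also have "\<dots> \<le> (LBINT x:cell i. \<eta> + B * (w a - w (a + h)))"
      by (intro set_integral_mono ci set_integrable_abs set_integral_diff(1) i1 pt)
    also have "\<dots> = h * \<eta> + B * h * (w a - w (a + h))"
      using h by (simp add: cell set_integral_const algebra_simps)
    finally show ?thesis unfolding ah unfolding a_def .
  qed
  have "(LBINT x:{0..<real (Suc N) * h}. w x * f x) = (\<Sum>i\<le>N. LBINT x:cell i. w x * f x)"
    unfolding cell_def using set_integral_consecutive_cells[OF h int, of 0 N] by simp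
  then have "\<bar>(\<Sum>i\<le>N. w (real i * h) * (h * f (real i * h))) - (LBINT x:{0..<real (Suc N) * h}. w x * f x)\<bar>
    = \<bar>\<Sum>i\<le>N. w (real i * h) * (h * f (real i * h)) - (LBINT x:cell i. w x * f x)\<bar>"
    by (simp add: sum_subtractf)
  also have "\<dots> \<le> (\<Sum>i\<le>N. h * \<eta> + B * h * (w (real i * h) - w (real (Suc i) * h)))"
    by (intro order_trans[OF sum_abs] sum_mono cellbd)
  also have "\<dots> = real (Suc N) * h * \<eta> + B * h * (w 0 - w (real (Suc N) * h))"
    using sum_lessThan_telescope'[of "\<lambda>i. w (real i * h)" "Suc N"]
    by (simp add: sum.distrib sum_distrib_left[symmetric] lessThan_Suc_atMost)
  also have "\<dots> \<le> real (Suc N) * h * \<eta> + B * h * 1"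
    using w(1)[of "real (Suc N) * h"] w(2) B0 h by (intro add_left_mono mult_left_mono) auto
  finally show ?thesis by simp
qed

text \<open>Dominated convergence is applied along a sequence of points at which the claimed
  estimate fails, which makes the convergence uniform.\<close>

lemma kernel_smoothing_uniform:
  fixes K f :: "real \<Rightarrow> real" and h :: "nat \<Rightarrow> real"
  assumes K: "integrable lborel K" "(LBINT x. K x) = 1"
    and f: "uniformly_continuous_on UNIV f" "bounded (range f)"
    and h: "\<And>n. n \<ge> 1 \<Longrightarrow> h n > 0" "h \<longlonglongrightarrow> 0" and \<epsilon>: "\<epsilon> > 0"
  shows "\<forall>\<^sub>F n in sequentially. \<forall>x. \<bar>(LBINT y. f y * K ((x - y) / h n)) - h n * f x\<bar> \<le> h n * \<epsilon>"
proof -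
  obtain B where B: "\<And>x. \<bar>f x\<bar> \<le> B" using f(2) unfolding bounded_iff by auto
  have fm [measurable]: "f \<in> borel_measurable borel"
    using f(1) by (intro borel_measurable_continuous_onI uniformly_continuous_imp_continuous)
  have Km [measurable]: "K \<in> borel_measurable borel" using K(1) by (auto dest: borel_measurable_integrable)
  define D where "D n x = (LBINT u. K u * (f (x - h n * u) - f x))" for n x
  have Kf: "integrable lborel (\<lambda>u. K u * f (x - h n * u))" for n x
  proof (rule Bochner_Integration.integrable_bound)
    show "integrable lborel (\<lambda>u. \<bar>K u\<bar> * B)" using K by simp
    show "AE u in lborel. norm (K u * f (x - h n * u)) \<le> norm (\<bar>K u\<bar> * B)"
      using B by (auto simp: abs_mult intro!: AE_I2 mult_left_mono order_trans[OF B])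
  qed measurable
  \<comment> \<open>The substitution \<open>y = x - h n * u\<close> produces the factor
    \<open>h n\<close>, and since \<open>K\<close> has integral 1 the value \<open>f x\<close> can
    be taken under the integral.\<close>
  have eq: "(LBINT y. f y * K ((x - y) / h n)) - h n * f x = h n * D n x" if "n \<ge> 1" for n x
  proof -
    have hn: "h n > 0" using h(1) that .
    have "(LBINT y. f y * K ((x - y) / h n)) = h n * (LBINT u. K u * f (x - h n * u))"
      using hn by (subst lborel_integral_real_affine[where c="-h n" and t=x]) (auto simp: mult.commute)
    moreover have "D n x = (LBINT u. K u * f (x - h n * u)) - f x"
      unfolding D_def right_diff_distrib using Kf[of x n] K by simp
    ultimately show ?thesis by (simp only: right_diff_distrib)
  qed
  define x where "x n = (SOME x. \<epsilon> < \<bar>D n x\<bar>)" for n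
  have "(\<lambda>n. D n (x n)) \<longlonglongrightarrow> (LBINT u::real. 0)"
    unfolding D_def
  proof (rule integral_dominated_convergence[where w="\<lambda>u. \<bar>K u\<bar> * (2 * B)"])
    show "integrable lborel (\<lambda>u. \<bar>K u\<bar> * (2 * B))" using K by simp
    show "AE u in lborel. (\<lambda>n. K u * (f (x n - h n * u) - f (x n))) \<longlonglongrightarrow> 0"
    proof (rule AE_I2)
      \<comment> \<open>The base points \<open>x n\<close> move with \<open>n\<close>, so pointwise
        continuity would not do; uniform continuity gives one \<open>d\<close> for all of
        them.\<close>
      fix u
      have "(\<lambda>n. f (x n - h n * u) - f (x n)) \<longlonglongrightarrow> 0"
      proof (rule LIMSEQ_I)
        fix r :: real assume "r > 0"
        then obtain d where d: "d > 0" "\<And>a b. dist b a < d \<Longrightarrow> dist (f b) (f a) < r"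
          using f(1) unfolding uniformly_continuous_on_def by auto
        have "(\<lambda>n. h n * u) \<longlonglongrightarrow> 0" using tendsto_mult_left_zero[OF h(2)] by simp
        then obtain n0 where "\<And>n. n \<ge> n0 \<Longrightarrow> \<bar>h n * u\<bar> < d"
          using LIMSEQ_D[OF _ d(1)] by fastforce
        then show "\<exists>no. \<forall>n\<ge>no. norm (f (x n - h n * u) - f (x n) - 0) < r"
          using d(2) by (intro exI[of _ n0]) (auto simp: dist_real_def)
      qed
      then show "(\<lambda>n. K u * (f (x n - h n * u) - f (x n))) \<longlonglongrightarrow> 0"
        by (rule tendsto_mult_right_zero)
    qed
    show "AE u in lborel. norm (K u * (f (x n - h n * u) - f (x n))) \<le> \<bar>K u\<bar> * (2 * B)" for n
    proof (rule AE_I2)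
      fix u
      have "\<bar>f (x n - h n * u) - f (x n)\<bar> \<le> 2 * B"
        using B[of "x n - h n * u"] B[of "x n"] by linarith
      then show "norm (K u * (f (x n - h n * u) - f (x n))) \<le> \<bar>K u\<bar> * (2 * B)"
        by (auto simp: abs_mult intro!: mult_left_mono)
    qed
  qed measurable
  then have "\<forall>\<^sub>F n in sequentially. \<bar>D n (x n)\<bar> < \<epsilon>"
    using \<epsilon> order_tendstoD(2)[OF tendsto_rabs_zero] by fastforce
  then show ?thesis
    using eventually_ge_at_top[of 1]
  proof eventually_elim
    case (elim n)
    have "\<bar>D n y\<bar> \<le> \<epsilon>" for y
    proof (rule ccontr)
      assume "\<not> \<bar>D n y\<bar> \<le> \<epsilon>"
      then have "\<epsilon> < \<bar>D n (x n)\<bar>" unfolding x_def by (intro someI[of "\<lambda>x. \<epsilon> < \<bar>D n x\<bar>" y]) simp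
      with elim show False by simp
    qed
    then show ?case using eq[OF elim(2)] h(1)[OF elim(2)] by (simp add: abs_mult)
  qed
qed

section \<open>Concentration of averages and Borel-Cantelli\<close>

text \<open>Hoeffding's inequality for \<open>n\<close> variables with values in an interval of
  length \<open>2 * C\<close>: the exponent is twice the square of \<open>n * e\<close> divided by
  \<open>n\<close> times \<open>4 * C\<^sup>2\<close>.\<close>

lemma (in prob_space) average_deviation:
  fixes X :: "nat \<Rightarrow> 'a \<Rightarrow> real" and f g :: "real \<Rightarrow> real"
  assumes indep: "indep_vars (\<lambda>_. borel) X {1..}"
    and dist: "\<And>j. j \<ge> 1 \<Longrightarrow> distributed M lborel (X j) (\<lambda>x. ennreal (f x))"
    and f: "\<And>x. f x \<ge> 0" and gm [measurable]: "g \<in> borel_measurable borel"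
    and g: "\<And>x. \<bar>g x\<bar> \<le> C" and C: "C > 0" and e: "e > 0" and n: "n \<ge> 1"
  shows "prob {\<omega>\<in>space M. e \<le> \<bar>1 / real n * (\<Sum>j=1..n. g (X j \<omega>)) - (LBINT x. f x * g x)\<bar>}
           \<le> 2 * exp (- (e\<^sup>2 / (2 * C\<^sup>2)) * real n)"
proof -
  define Y where "Y j \<omega> = g (X j \<omega>)" for j \<omega>
  define E where "E = (LBINT x. f x * g x)"
  have ind: "indep_vars (\<lambda>_. borel) Y {1..n}"
    unfolding Y_def by (rule indep_vars_compose2[OF indep_vars_subset[OF indep]]) auto
  interpret I: indep_interval_bounded_random_variables M "{1..n}" Y "\<lambda>_. - C" "\<lambda>_. C"
  proof
    show "AE x in M. Y i x \<in> {- C..C}" for i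
      using g by (auto simp: Y_def abs_le_iff minus_le_iff intro!: AE_I2)
  qed (use ind in auto)
  have EY: "expectation (Y j) = E" if "j \<in> {1..n}" for j
    unfolding Y_def E_def using that f by (subst distributed_integral[OF dist, symmetric]) auto
  interpret H: Hoeffding_ineq M "{1..n}" Y "\<lambda>_. - C" "\<lambda>_. C" "real n * E"
    by unfold_locales (simp add: EY)
  have s: "(\<Sum>i\<in>{1..n}. (C - - C)\<^sup>2) = real n * (4 * C\<^sup>2)"
    by (simp add: power2_eq_square)
  have "{\<omega>\<in>space M. e \<le> \<bar>1 / real n * (\<Sum>j=1..n. g (X j \<omega>)) - (LBINT x. f x * g x)\<bar>}
      = {\<omega>\<in>space M. real n * e \<le> \<bar>(\<Sum>j=1..n. Y j \<omega>) - real n * E\<bar>}"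
  proof (intro Collect_cong conj_cong refl)
    fix \<omega>
    have "\<bar>(\<Sum>j=1..n. Y j \<omega>) - real n * E\<bar> = real n * \<bar>1 / real n * (\<Sum>j=1..n. Y j \<omega>) - E\<bar>"
    proof -
      have "(\<Sum>j=1..n. Y j \<omega>) - real n * E = real n * (1 / real n * (\<Sum>j=1..n. Y j \<omega>) - E)"
        using n by (simp add: field_simps)
      then show ?thesis by (simp only: abs_mult abs_of_nat)
    qed
    then show "(e \<le> \<bar>1 / real n * (\<Sum>j=1..n. g (X j \<omega>)) - (LBINT x. f x * g x)\<bar>)
      \<longleftrightarrow> (real n * e \<le> \<bar>(\<Sum>j=1..n. Y j \<omega>) - real n * E\<bar>)"
      using n by (simp add: Y_def E_def)
  qed
  also have "prob \<dots> \<le> 2 * exp (-2 * (real n * e)\<^sup>2 / (\<Sum>i\<in>{1..n}. (C - - C)\<^sup>2))"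
    using n C e by (intro H.Hoeffding_ineq_abs_ge) (auto simp: s)
  also have "-2 * (real n * e)\<^sup>2 / (\<Sum>i\<in>{1..n}. (C - - C)\<^sup>2) = - (e\<^sup>2 / (2 * C\<^sup>2)) * real n"
    unfolding s using n C by (simp add: field_simps power2_eq_square)
  finally show ?thesis .
qed

text \<open>The averaged functions change with \<open>n\<close>, so the strong law does not apply
  directly. A union bound over the \<open>N n + 1\<close> functions at stage \<open>n\<close> costs
  a factor that the summability hypothesis absorbs, and Borel-Cantelli concludes.\<close>

lemma (in prob_space) triangular_averages_converge:
  fixes X :: "nat \<Rightarrow> 'a \<Rightarrow> real" and f :: "real \<Rightarrow> real" and g :: "nat \<Rightarrow> nat \<Rightarrow> real \<Rightarrow> real"
    and N :: "nat \<Rightarrow> nat"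
  assumes indep: "indep_vars (\<lambda>_. borel) X {1..}"
    and dist: "\<And>j. j \<ge> 1 \<Longrightarrow> distributed M lborel (X j) (\<lambda>x. ennreal (f x))"
    and f: "\<And>x. f x \<ge> 0" and gm [measurable]: "\<And>n m. g n m \<in> borel_measurable borel"
    and g: "\<And>n m x. n \<ge> 1 \<Longrightarrow> \<bar>g n m x\<bar> \<le> C" and C: "C > 0"
    and N: "\<And>c. c > 0 \<Longrightarrow> summable (\<lambda>n. real (Suc (N n)) * exp (- c * real n))"
  shows "AE \<omega> in M. \<forall>e>0. \<forall>\<^sub>F n in sequentially. \<forall>m\<le>N n.
    \<bar>1 / real n * (\<Sum>j=1..n. g n m (X j \<omega>)) - (LBINT x. f x * g n m x)\<bar> < e"
proof -
  define dev where "dev n m \<omega> = \<bar>1 / real n * (\<Sum>j=1..n. g n m (X j \<omega>)) - (LBINT x. f x * g n m x)\<bar>"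
    for n m \<omega>
  have Xm: "X j \<in> borel_measurable M" if "j \<in> {1..n}" for j n
    using indep that unfolding indep_vars_def by auto
  have dm [measurable]: "dev n m \<in> borel_measurable M" for n m
  proof -
    have "(\<lambda>\<omega>. \<bar>1 / real n * (\<Sum>j=1..n. g n m (X j \<omega>)) - c\<bar>) \<in> borel_measurable M" for c
      by (intro borel_measurable_abs borel_measurable_diff borel_measurable_times borel_measurable_sum
        borel_measurable_const measurable_compose[OF Xm gm]) auto
    then show ?thesis unfolding dev_def .
  qed
  have fixed: "AE \<omega> in M. \<forall>\<^sub>F n in sequentially. \<forall>m\<le>N n. dev n m \<omega> < e" if e: "e > 0" for e
  proof -
    define A where "A n = {\<omega>\<in>space M. \<exists>m\<le>N n. e \<le> dev n m \<omega>}" for n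
    have Am: "A n \<in> sets M" for n unfolding A_def by measurable
    have PA: "prob (A n) \<le> 2 * (real (Suc (N n)) * exp (- (e\<^sup>2 / (2 * C\<^sup>2)) * real n))" if n: "n \<ge> 1" for n
    proof -
      have "A n = (\<Union>m\<in>{..N n}. {\<omega>\<in>space M. e \<le> dev n m \<omega>})" by (auto simp: A_def)
      also have "prob \<dots> \<le> (\<Sum>m\<le>N n. prob {\<omega>\<in>space M. e \<le> dev n m \<omega>})"
        by (rule finite_measure_subadditive_finite) auto
      also have "\<dots> \<le> (\<Sum>m\<le>N n. 2 * exp (- (e\<^sup>2 / (2 * C\<^sup>2)) * real n))"
        unfolding dev_def
        by (intro sum_mono average_deviation indep dist f gm g C e n)
      also have "\<dots> = 2 * (real (Suc (N n)) * exp (- (e\<^sup>2 / (2 * C\<^sup>2)) * real n))" by simp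
      finally show ?thesis .
    qed
    have "summable (\<lambda>n. 2 * (real (Suc (N n)) * exp (- (e\<^sup>2 / (2 * C\<^sup>2)) * real n)))"
      using e C by (intro summable_mult N) simp
    then have "summable (\<lambda>n. prob (A n))"
      by (rule summable_comparison_test[rotated]) (use PA in auto)
    then have "AE \<omega> in M. \<forall>\<^sub>F n in sequentially. \<omega> \<in> space M - A n"
      by (intro borel_cantelli_AE1 Am) (auto simp: less_top[symmetric])
    then show ?thesis
      proof eventually_elim
      case (elim \<omega>)
      then show ?case
        by (rule eventually_mono) (simp add: A_def, metis not_le)
    qed
  qed
  \<comment> \<open>The exceptional null set depends on the tolerance; the countably many tolerances
    \<open>1 / real (Suc k)\<close> give a single one.\<close>
  have "AE \<omega> in M. \<forall>k. \<forall>\<^sub>F n in sequentially. \<forall>m\<le>N n. dev n m \<omega> < 1 / real (Suc k)"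
    unfolding AE_all_countable by (intro allI fixed) simp
  then have "AE \<omega> in M. \<forall>e>0. \<forall>\<^sub>F n in sequentially. \<forall>m\<le>N n. dev n m \<omega> < e"
  proof eventually_elim
    case (elim \<omega>)
    show ?case
    proof (intro allI impI)
      fix e :: real assume "e > 0"
      then obtain k where "1 / real (Suc k) < e" by (rule nat_approx_posE)
      then show "\<forall>\<^sub>F n in sequentially. \<forall>m\<le>N n. dev n m \<omega> < e"
        using elim[rule_format, of k] by (auto elim!: eventually_mono intro: order.strict_trans)
    qed
  qed
  then show ?thesis by (simp add: dev_def)
qed

section \<open>Decomposition of the error, and the bandwidth condition\<close>

text \<open>A deterministic estimate for one sample. The terms account in turn for the random
  deviation, the part with \<open>second_deriv K\<close>, the smoothing and Riemann sum errors
  together, and the drop of the weight. The bound contains \<open>M\<close> but not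
  \<open>z\<close>, hence the uniformity.\<close>

lemma fgt_error_bound:
  fixes K f :: "real \<Rightarrow> real" and x :: "nat \<Rightarrow> real"
  assumes \<alpha>: "\<alpha> \<ge> 0" and h: "h > 0" and n: "n \<ge> 1" and z: "0 < z" "z \<le> M"
    and Km [measurable]: "K \<in> borel_measurable borel" and K: "\<And>x. \<bar>K x\<bar> \<le> C"
    and f: "integrable lborel f" "\<And>x. 0 \<le> f x" "\<And>x. f x \<le> B"
    and dev: "\<And>m. m \<le> nat \<lfloor>M / h\<rfloor> \<Longrightarrow>
        \<bar>1 / real n * (\<Sum>j=1..n. \<Sum>i\<le>m. K ((real i * h - x j) / h))
           - (LBINT y. f y * (\<Sum>i\<le>m. K ((real i * h - y) / h)))\<bar> \<le> e\<^sub>1"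
    and smooth: "\<And>x. \<bar>(LBINT y. f y * K ((x - y) / h)) - h * f x\<bar> \<le> h * e\<^sub>2"
    and modulus: "\<And>x y. \<bar>x - y\<bar> \<le> h \<Longrightarrow> \<bar>f x - f y\<bar> \<le> e\<^sub>3"
    and D: "\<And>t m. (\<Sum>i\<le>m. \<bar>second_deriv K (real i - t)\<bar>) \<le> D"
  shows "\<bar>fgt_estimator K h n x \<alpha> z - fgt_index f \<alpha> z\<bar>
    \<le> e\<^sub>1 + h\<^sup>2 / 2 * \<bar>LBINT u. u\<^sup>2 * K u\<bar> * D + (M + h) * (e\<^sub>2 + e\<^sub>3) + B * h"
proof -
  define N where "N = nat \<lfloor>z / h\<rfloor>"
  define w where "w i = fgt_weight \<alpha> z (real i * h)" for i
  define c where "c = h\<^sup>2 / 2 * (LBINT u. u\<^sup>2 * K u)"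
  define E where "E i = (LBINT y. f y * K ((real i * h - y) / h))" for i
  define a where "a i = 1 / real n * (\<Sum>j=1..n. K ((real i * h - x j) / h)) - E i" for i
  define T where "T = 1 / real n * (\<Sum>j=1..n. \<Sum>i\<le>N. w i * second_deriv K ((real i * h - x j) / h))"
  have fm [measurable]: "f \<in> borel_measurable borel" using f(1) by (auto dest: borel_measurable_integrable)
  have fl: "real_of_int \<lfloor>z / h\<rfloor> = real N" using h z by (simp add: N_def)
  have N1: "real N * h \<le> z" using of_int_floor_le[of "z / h"] h unfolding fl by (simp add: field_simps)
  have N2: "z < real (Suc N) * h" 
    using floor_correct[of "z / h"] h fl by (simp add: field_simps)
  have NM: "N \<le> nat \<lfloor>M / h\<rfloor>"
    unfolding N_def using z h by (intro nat_mono floor_mono divide_right_mono) auto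
  have w01: "0 \<le> w i" "w i \<le> 1" for i
    using h z \<alpha> by (auto simp: w_def intro!: fgt_weight_nonneg fgt_weight_le_1)
  have e2: "0 \<le> e\<^sub>2" using smooth[of 0] h by (smt (verit) mult_pos_neg)
  have e3: "0 \<le> e\<^sub>3" using modulus[of 0 0] h by simp
  \<comment> \<open>The lattice points up to index \<open>N\<close> do not exceed \<open>z\<close>,
    so the cut-off in \<open>fgt_weight\<close> leaves the weights of the estimator
    unchanged.\<close>
  have wi: "fgt_power ((z - real i * h) / z) \<alpha> = w i" if "i \<le> N" for i
  proof -
    have "real i * h \<le> real N * h" using that h by (intro mult_right_mono) auto
    then show ?thesis using N1 by (simp add: w_def fgt_weight_def)
  qed
  have "fgt_estimator K h n x \<alpha> z = 1 / real n * (\<Sum>j=1..n. \<Sum>i\<le>N. w i *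
      (K ((real i * h - x j) / h) - c * second_deriv K ((real i * h - x j) / h)))"
    using z wi by (simp add: fgt_estimator_def N_def[symmetric] c_def atLeast0AtMost)
  also have "\<dots> = 1 / real n * (\<Sum>j=1..n. \<Sum>i\<le>N. w i * K ((real i * h - x j) / h)) - c * T"
    by (simp add: T_def right_diff_distrib sum_subtractf sum_distrib_left mult_ac)
  also have "(\<Sum>j=1..n. \<Sum>i\<le>N. w i * K ((real i * h - x j) / h))
      = (\<Sum>i\<le>N. w i * (\<Sum>j=1..n. K ((real i * h - x j) / h)))"
    by (subst sum.swap) (simp add: sum_distrib_left)
  also have "1 / real n * \<dots> = (\<Sum>i\<le>N. w i * a i) + (\<Sum>i\<le>N. w i * E i)"
    by (simp add: a_def right_diff_distrib sum_subtractf sum_distrib_left mult_ac)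
  also have "(\<Sum>i\<le>N. w i * E i) = (\<Sum>i\<le>N. w i * (E i - h * f (real i * h))) + (\<Sum>i\<le>N. w i * (h * f (real i * h)))"
    by (simp add: right_diff_distrib sum_subtractf)
  finally have est: "fgt_estimator K h n x \<alpha> z = (\<Sum>i\<le>N. w i * a i) + ((\<Sum>i\<le>N. w i * (E i - h * f (real i * h)))
      + (\<Sum>i\<le>N. w i * (h * f (real i * h)))) - c * T" .
  \<comment> \<open>The partial sums of \<open>a\<close> are the deviations in \<open>dev\<close>.
    They do not involve \<open>z\<close>, which enters only through the weights and through
    \<open>N\<close>, at most \<open>nat \<lfloor>M / h\<rfloor>\<close>.\<close>
  have b1: "\<bar>\<Sum>i\<le>N. w i * a i\<bar> \<le> e\<^sub>1"
  proof (rule abel_sum_bound)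
    show "w (Suc i) \<le> w i" for i
      unfolding w_def using h z \<alpha> by (intro fgt_weight_antimono) auto
    fix m assume m: "m \<le> N"
    have int: "integrable lborel (\<lambda>y. f y * K ((t - y) / h))" for t
    proof (rule Bochner_Integration.integrable_bound)
      show "integrable lborel (\<lambda>y. f y * C)" using f by simp
      show "AE y in lborel. norm (f y * K ((t - y) / h)) \<le> norm (f y * C)"
        using f(2) by (auto simp: abs_mult intro!: AE_I2 mult_left_mono order_trans[OF K])
    qed measurable
    have "(\<Sum>i\<le>m. a i) = 1 / real n * (\<Sum>j=1..n. \<Sum>i\<le>m. K ((real i * h - x j) / h)) - (\<Sum>i\<le>m. E i)"
      by (subst sum.swap) (simp add: a_def sum_subtractf sum_distrib_left)
    also have "(\<Sum>i\<le>m. E i) = (LBINT y. f y * (\<Sum>i\<le>m. K ((real i * h - y) / h)))"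
      unfolding E_def sum_distrib_left by (rule Bochner_Integration.integral_sum[symmetric]) (rule int)
    finally show "\<bar>\<Sum>i\<le>m. a i\<bar> \<le> e\<^sub>1" using dev[of m] m NM by simp
  qed (use w01 in auto)
  \<comment> \<open>There are \<open>N + 1\<close> terms of size at most
    \<open>h * e\<^sub>2\<close>, and \<open>N * h\<close> is at most \<open>M\<close>; the extra
    term is the \<open>h\<close> in \<open>M + h\<close>.\<close>
  have b2: "\<bar>\<Sum>i\<le>N. w i * (E i - h * f (real i * h))\<bar> \<le> (M + h) * e\<^sub>2"
  proof -
    have "\<bar>\<Sum>i\<le>N. w i * (E i - h * f (real i * h))\<bar> \<le> (\<Sum>i\<le>N. 1 * (h * e\<^sub>2))"
      using w01 smooth unfolding E_def
      by (intro order_trans[OF sum_abs] sum_mono) (simp add: abs_mult mult_le_one order_trans[OF mult_left_le_one_le])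
    also have "\<dots> = (real N * h + h) * e\<^sub>2" by (simp add: algebra_simps)
    also have "\<dots> \<le> (M + h) * e\<^sub>2" using N1 z e2 by (intro mult_right_mono) auto
    finally show ?thesis .
  qed
  have b3: "\<bar>(\<Sum>i\<le>N. w i * (h * f (real i * h))) - fgt_index f \<alpha> z\<bar> \<le> (M + h) * e\<^sub>3 + B * h"
  proof -
    \<comment> \<open>The last cell ends strictly after \<open>z\<close>, so the half-open interval
      contains \<open>{0..z}\<close>, and the weight vanishes on the rest.\<close>
    have "fgt_index f \<alpha> z = (LBINT x:{0..<real (Suc N) * h}. fgt_weight \<alpha> z x * f x)"
      using z N2 unfolding fgt_index_def set_lebesgue_integral_def
      by (auto intro!: Bochner_Integration.integral_cong simp: fgt_weight_def indicator_def)
    then have "\<bar>(\<Sum>i\<le>N. w i * (h * f (real i * h))) - fgt_index f \<alpha> z\<bar>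
        \<le> real (Suc N) * h * e\<^sub>3 + B * h"
      unfolding w_def using z \<alpha> fgt_weight_0[of z \<alpha>]
      by (simp only:) (intro antimono_riemann_sum h fgt_weight_measurable fgt_weight_nonneg
        fgt_weight_antimono fm f modulus, auto)
    also have "\<dots> \<le> (M + h) * e\<^sub>3 + B * h"
      using N1 z e3 by (intro add_right_mono mult_right_mono) (auto simp: algebra_simps)
    finally show ?thesis .
  qed
  \<comment> \<open>For each observation the lattice sum is at most \<open>D\<close>; averaging over
    \<open>j\<close> preserves this, and \<open>c\<close> supplies the factor of order
    \<open>h\<^sup>2\<close>.\<close>
  have b4: "\<bar>c * T\<bar> \<le> h\<^sup>2 / 2 * \<bar>LBINT u. u\<^sup>2 * K u\<bar> * D"
  proof -
    have "\<bar>\<Sum>i\<le>N. w i * second_deriv K ((real i * h - x j) / h)\<bar> \<le> D" for j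
    proof -
      have "\<bar>\<Sum>i\<le>N. w i * second_deriv K ((real i * h - x j) / h)\<bar>
          \<le> (\<Sum>i\<le>N. \<bar>second_deriv K (real i - x j / h)\<bar>)"
        using w01 h by (intro order_trans[OF sum_abs] sum_mono)
          (simp add: abs_mult diff_divide_distrib mult_left_le_one_le)
      also have "\<dots> \<le> D" by (rule D)
      finally show ?thesis .
    qed
    then have "\<bar>\<Sum>j=1..n. \<Sum>i\<le>N. w i * second_deriv K ((real i * h - x j) / h)\<bar> \<le> (\<Sum>j=1..n. D)"
      by (intro order_trans[OF sum_abs sum_mono])
    then have "\<bar>T\<bar> \<le> D" using n by (simp add: T_def abs_mult field_simps)
    then have "\<bar>c\<bar> * \<bar>T\<bar> \<le> \<bar>c\<bar> * D" by (rule mult_left_mono) simp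
    then show ?thesis by (simp add: c_def abs_mult)
  qed
  show ?thesis unfolding est distrib_left using b1 b2 b3 b4 by linarith
qed

text \<open>The growth condition makes \<open>1 / h n\<close> at most \<open>n\<close> eventually,
  so the number of lattice indices grows at most linearly and the exponential dominates it.\<close>

lemma bandwidth_lattice_summable:
  fixes h :: "nat \<Rightarrow> real"
  assumes h: "\<And>n. n \<ge> 1 \<Longrightarrow> h n > 0"
    and lim: "filterlim (\<lambda>n. real n * (h n)\<^sup>2 / ln (ln (real n))) at_top sequentially"
    and M: "M > 0" and c: "c > 0"
  shows "summable (\<lambda>n. real (Suc (nat \<lfloor>M / h n\<rfloor>)) * exp (- c * real n))"
proof (rule summable_comparison_test_ev)
  show "summable (\<lambda>n. inverse (real n ^ 2))" by (rule inverse_power_summable) simp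
  have ev1: "\<forall>\<^sub>F n in sequentially. 1 \<le> real n * (h n)\<^sup>2 / ln (ln (real n))"
    using lim by (simp add: filterlim_at_top)
  have ev2: "\<forall>\<^sub>F n in sequentially. 0 < ln (ln (real n))" by real_asymp
  have ev3: "\<forall>\<^sub>F n in sequentially. 1 \<le> real n * ln (ln (real n))" by real_asymp
  have ev4: "\<forall>\<^sub>F n in sequentially. (M * real n + 1) * exp (- c * real n) \<le> inverse (real n ^ 2)"
    using M c by real_asymp
  show "\<forall>\<^sub>F n in sequentially. norm (real (Suc (nat \<lfloor>M / h n\<rfloor>)) * exp (- c * real n)) \<le> inverse (real n ^ 2)"
    using ev1 ev2 ev3 ev4 eventually_ge_at_top[of 1]
  proof eventually_elim
    case (elim n)
    have hn: "h n > 0" using h elim by simp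
    have "ln (ln (real n)) \<le> real n * (h n)\<^sup>2" using elim(1,2) by (simp add: field_simps)
    \<comment> \<open>Multiplying by \<open>n\<close> turns the lower bound on
      \<open>n * (h n)\<^sup>2\<close> into one on the square of \<open>n * h n\<close>, as
      \<open>n * ln (ln n)\<close> is eventually at least 1.\<close>
    then have "1 \<le> real n * (real n * (h n)\<^sup>2)"
      using elim(3) by (meson mult_left_mono of_nat_0_le_iff order_trans)
    then have "1\<^sup>2 \<le> (real n * h n)\<^sup>2" by (simp add: power2_eq_square mult_ac)
    then have "1 \<le> real n * h n" by (rule power2_le_imp_le) (use hn in simp)
    then have "M / h n \<le> M * real n"
      using M hn by (simp add: field_simps)
    then have "real (Suc (nat \<lfloor>M / h n\<rfloor>)) \<le> M * real n + 1"
      using M hn order_trans[OF of_int_floor_le[of "M / h n"]] by simp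
    then have "real (Suc (nat \<lfloor>M / h n\<rfloor>)) * exp (- c * real n) \<le> (M * real n + 1) * exp (- c * real n)"
      by (intro mult_right_mono) auto
    also note elim(4)
    finally show ?case by simp
  qed
qed

section \<open>Almost sure uniform convergence\<close>

theorem theorem1:
  fixes P :: "'a measure" and X :: "nat \<Rightarrow> 'a \<Rightarrow> real"
    and f K :: "real \<Rightarrow> real" and h :: "nat \<Rightarrow> real" and \<alpha> M :: real
  assumes "\<alpha> = 0 \<or> \<alpha> \<ge> 1"
    and "prob_space P"
    and "prob_space.indep_vars P (\<lambda>_. borel) X {1..}"
    and "\<And>j. j \<ge> 1 \<Longrightarrow> distributed P lborel (X j) (\<lambda>x. ennreal (f x))"
    and "\<And>x. f x \<ge> 0"
    and "continuous_on UNIV f"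
    and "bounded (range f)"
    and "closure {x. f x \<noteq> 0} \<subseteq> {0..}"
    and "\<And>n. n \<ge> 1 \<Longrightarrow> h n > 0"
    and "h \<longlonglongrightarrow> 0"
    and "bias_reducing_kernel K"
    and "bounded_variation K"
    and "bounded_variation (second_deriv K)"
    and "uniformly_continuous_on UNIV f"
    and "filterlim (\<lambda>n. real n * (h n)\<^sup>2 / ln (ln (real n))) at_top sequentially"
    and "M > 0"
  shows "AE \<omega> in P.
    (\<lambda>n. SUP z\<in>{0..M}.
        ereal \<bar>fgt_estimator K (h n) n (\<lambda>j. X j \<omega>) \<alpha> z - fgt_index f \<alpha> z\<bar>)
      \<longlonglongrightarrow> 0"
proof -
  note indep = assms(3) and dist = assms(4) and f0 = assms(5) and hpos = assms(9)
    and h0 = assms(10) and ker = assms(11) and funif = assms(14) and M = assms(16)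
  interpret prob_space P by fact
  have \<alpha>: "\<alpha> \<ge> 0" using assms(1) by auto
  have C2_cont: "continuous_on UNIV g" if "C2 g" for g
    using that unfolding C2_def by (auto intro: differentiable_imp_continuous_on)
  have Kc: "continuous_on UNIV K" and Ki: "integrable lborel K" and K1: "(LBINT x. K x) = 1"
    and Lc: "continuous_on UNIV (second_deriv K)" and Li: "integrable lborel (second_deriv K)"
    using ker by (auto simp: bias_reducing_kernel_def intro: C2_cont)
  have Km [measurable]: "K \<in> borel_measurable borel" by (rule borel_measurable_continuous_onI[OF Kc])
  obtain C where C: "C > 0" "\<And>t m. (\<Sum>i\<le>m. \<bar>K (real i - t)\<bar>) \<le> C"
    using lattice_sum_bounded[OF Kc Ki assms(12)] by blast
  obtain D where D: "D > 0" "\<And>t m. (\<Sum>i\<le>m. \<bar>second_deriv K (real i - t)\<bar>) \<le> D"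
    using lattice_sum_bounded[OF Lc Li assms(13)] by blast
  \<comment> \<open>A lattice sum with the single term \<open>i = 0\<close> and shift
    \<open>-x\<close>.\<close>
  have KC: "\<bar>K x\<bar> \<le> C" for x using C(2)[of "-x" 0] by simp
  obtain B where "\<And>x. \<bar>f x\<bar> \<le> B" using assms(7) unfolding bounded_iff by auto
  then have B: "f x \<le> B" for x using abs_le_D1 by blast
  \<comment> \<open>The constant 1 is integrable under \<open>P\<close>; read through the density of
    \<open>X 1\<close>, this is integrability of \<open>f\<close>.\<close>
  have fi: "integrable lborel f"
    using distributed_integrable[OF dist[of 1], of "\<lambda>_. 1"] f0 by simp
  define c where "c = \<bar>LBINT u. u\<^sup>2 * K u\<bar>"
  have gC: "\<bar>\<Sum>i\<le>m. K ((real i * h n - y) / h n)\<bar> \<le> C" if "n \<ge> 1" for n m y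
    using order_trans[OF sum_abs C(2)[of "y / h n" m]] hpos[OF that]
    by (simp add: diff_divide_distrib)
  have "AE \<omega> in P. \<forall>e>0. \<forall>\<^sub>F n in sequentially. \<forall>m\<le>nat \<lfloor>M / h n\<rfloor>.
    \<bar>1 / real n * (\<Sum>j=1..n. \<Sum>i\<le>m. K ((real i * h n - X j \<omega>) / h n))
      - (LBINT x. f x * (\<Sum>i\<le>m. K ((real i * h n - x) / h n)))\<bar> < e"
    using C(1) gC hpos M assms(15)
    by (intro triangular_averages_converge[OF indep dist f0] bandwidth_lattice_summable) auto
  then show ?thesis
  proof eventually_elim
    case (elim \<omega>)
    define R where "R n z = \<bar>fgt_estimator K (h n) n (\<lambda>j. X j \<omega>) \<alpha> z - fgt_index f \<alpha> z\<bar>" for n z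
    have unif: "\<forall>\<^sub>F n in sequentially. \<forall>z\<in>{0..M}. R n z \<le> e" if e: "e > 0" for e
    proof -
      \<comment> \<open>Smoothing and modulus of continuity each contribute \<open>d\<close>,
        multiplied by \<open>M + h n\<close>, which is at most \<open>M + 1\<close> once
        \<open>h n < 1\<close>; together they cost \<open>e / 4\<close>.\<close>
      define d where "d = e / (8 * (M + 1))"
      have d: "d > 0" using e M by (simp add: d_def)
      have Md: "(M + 1) * d = e / 8" using M by (simp add: d_def field_simps)
      obtain r where r: "r > 0" "\<And>x y. \<bar>x - y\<bar> < r \<Longrightarrow> \<bar>f x - f y\<bar> < d"
        using funif d unfolding uniformly_continuous_on_def dist_real_def by (metis UNIV_I)
      have "(\<lambda>n. (h n)\<^sup>2 / 2 * c * D + B * h n) \<longlonglongrightarrow> 0\<^sup>2 / 2 * c * D + B * 0"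
        by (intro tendsto_intros h0) auto
      then have "\<forall>\<^sub>F n in sequentially. (h n)\<^sup>2 / 2 * c * D + B * h n < e / 4"
        using e by (intro order_tendstoD(2)[where a = "e / 4"]) auto
      moreover have "\<forall>\<^sub>F n in sequentially. h n < min 1 r"
        using r h0 by (intro order_tendstoD(2)) auto
      moreover have "\<forall>\<^sub>F n in sequentially. \<forall>x. \<bar>(LBINT y. f y * K ((x - y) / h n)) - h n * f x\<bar> \<le> h n * d"
        by (rule kernel_smoothing_uniform[OF Ki K1 funif assms(7) hpos h0 d])
      moreover have "\<forall>\<^sub>F n in sequentially. \<forall>m\<le>nat \<lfloor>M / h n\<rfloor>.
        \<bar>1 / real n * (\<Sum>j=1..n. \<Sum>i\<le>m. K ((real i * h n - X j \<omega>) / h n))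
          - (LBINT x. f x * (\<Sum>i\<le>m. K ((real i * h n - x) / h n)))\<bar> < e / 4"
        using e by (intro mp[OF spec[OF elim]]) simp
      ultimately show ?thesis using eventually_ge_at_top[of 1]
      proof eventually_elim
        case (elim n)
        show ?case
        proof
          fix z assume z: "z \<in> {0..M}"
          show "R n z \<le> e"
          \<comment> \<open>At 0 estimator and index both vanish by convention; the error bound
            requires \<open>z > 0\<close>.\<close>
          proof (cases "z = 0")
            case True
            then show ?thesis using e by (simp add: R_def fgt_estimator_def fgt_index_def)
          next
            case False
            have "R n z \<le> e / 4 + (h n)\<^sup>2 / 2 * \<bar>LBINT u. u\<^sup>2 * K u\<bar> * D + (M + h n) * (d + d) + B * h n"
              unfolding R_def
            proof (rule fgt_error_bound[OF \<alpha> hpos[OF elim(5)] elim(5) _ _ Km KC fi f0 B])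
              show "\<bar>f x - f y\<bar> \<le> d" if "\<bar>x - y\<bar> \<le> h n" for x y
                using r(2)[of x y] that elim(2) by simp
            qed (use z False elim D(2) in \<open>auto intro: less_imp_le\<close>)
            also have "\<dots> \<le> e / 2 + (M + 1) * (d + d)"
              using elim(1,2) d mult_right_mono[of "M + h n" "M + 1" "d + d"] unfolding c_def by linarith
            also have "(M + 1) * (d + d) = e / 4" using Md by (simp add: distrib_left)
            finally show ?thesis using e by simp
          qed
        qed
      qed
    qed
    show ?case unfolding R_def[symmetric]
    proof (rule order_tendstoI)
      fix a :: ereal assume a: "a < 0"
      have "0 \<le> (SUP z\<in>{0..M}. ereal (R n z))" for n
        using M by (intro SUP_upper2[of 0]) (auto simp: R_def)
      then show "\<forall>\<^sub>F n in sequentially. a < (SUP z\<in>{0..M}. ereal (R n z))"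
        using a by (intro always_eventually allI) (rule less_le_trans)
    next
      fix a :: ereal assume "0 < a"
      \<comment> \<open>A real number strictly below \<open>a\<close> is chosen because the
        pointwise bound by \<open>e\<close> survives in the supremum only as a weak
        inequality.\<close>
      then obtain e where e: "0 < ereal e" "ereal e < a" using ereal_dense2 by blast
      from e(1) have "\<forall>\<^sub>F n in sequentially. \<forall>z\<in>{0..M}. R n z \<le> e" by (intro unif) simp
      then show "\<forall>\<^sub>F n in sequentially. (SUP z\<in>{0..M}. ereal (R n z)) < a"
        by eventually_elim (auto intro!: le_less_trans[OF _ e(2)] SUP_least)
    qed
  qed
qed

end
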